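(* Let $K$ be a compact, perfectly normal Hausdorff space and let $\mathbb{X}$ be a real Banach space. Let $T\in\mathbb{K}(\mathbb{X},C(K))$ with $\|T\|=1$. Then $T$ is left symmetric in $\mathbb{K}(\mathbb{X},C(K))$ if and only if both of the following hold: (i) there exists exactly one point $k_0\in K$ such that $\|T^*(\delta_{k_0})\|=1$ and $T^*(\delta_k)=0$ for all $k\in K\setminus\{k_0\}$; (ii) $T^*(\delta_{k_0})$ is a left symmetric point of $\mathbb{X}^*$. Moreover, if $K$ does not contain any isolated point, then an operator $T\in\mathbb{K}(\mathbb{X},C(K))$ is left symmetric in $\mathbb{K}(\mathbb{X},C(K))$ if and only if $T$ is the zero operator.
   Context: $C(K)$ is the Banach space of real-valued continuous functions on $K$ with the supremum norm. $\mathbb{K}(\mathbb{X},\mathbb{Y})$ is the Banach space of compact linear operators from $\mathbb{X}$ to $\mathbb{Y}$ with the operator norm. For $k\in K$, $\delta_k\in C(K)^*$ is given by $\delta_k(f)=f(k)$ for all $f\in C(K)$; $T^*:C(K)^*\to\mathbb{X}^*$ is the adjoint of $T$. A topological space is perfectly normal if it is normal and every closed subset is a $G_\delta$ set. For a real Banach space $\mathbb{Z}$ and $x,y\in\mathbb{Z}$, $x\perp_B y$ means $\|x+\lambda y\|\ge\|x\|$ for all $\lambda\in\mathbb{R}$. A point $x\in\mathbb{Z}$ is left symmetric (in $\mathbb{Z}$) if for all $y\in\mathbb{Z}$, $x\perp_B y$ implies $y\perp_B x$. *)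

theory Defs
  imports "HOL-Analysis.Analysis"
begin

definition perfectly_normal_space :: "'a topology \<Rightarrow> bool"
  where "perfectly_normal_space X \<longleftrightarrow>
    normal_space X \<and> (\<forall>C. closedin X C \<longrightarrow> gdelta_in X C)"

definition birkhoff_james :: "'a::real_normed_vector \<Rightarrow> 'a \<Rightarrow> bool"  (infix \<open>\<bottom>\<^sub>B\<close> 50)
  where "x \<bottom>\<^sub>B y \<longleftrightarrow> (\<forall>c::real. norm (x + c *\<^sub>R y) \<ge> norm x)"

text \<open>The space \<open>Z\<close> is represented as a subset of an ambient normed space whose norm it inherits;
  take \<open>Z = UNIV\<close> for the whole space.\<close>

definition left_symmetric_in :: "'a::real_normed_vector set \<Rightarrow> 'a \<Rightarrow> bool"
  where "left_symmetric_in Z x \<longleftrightarrow> x \<in> Z \<and> (\<forall>y\<in>Z. x \<bottom>\<^sub>B y \<longrightarrow> y \<bottom>\<^sub>B x)"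

definition compact_operators :: "('a::real_normed_vector \<Rightarrow>\<^sub>L 'b::real_normed_vector) set"
  where "compact_operators = {T. compact (closure (blinfun_apply T ` cball 0 1))}"

lift_definition banach_adjoint ::
    "('a::real_normed_vector \<Rightarrow>\<^sub>L 'b::real_normed_vector) \<Rightarrow> ('b \<Rightarrow>\<^sub>L real) \<Rightarrow>\<^sub>L ('a \<Rightarrow>\<^sub>L real)"
  is "\<lambda>T \<phi>. \<phi> o\<^sub>L T"
  by (rule bounded_bilinear.bounded_linear_left[OF bounded_bilinear_blinfun_compose])

text \<open>On a compact space every continuous function is bounded, so \<open>'k \<Rightarrow>\<^sub>C real\<close>
  (bounded continuous functions with the supremum norm) is the space of all real-valued
  continuous functions.\<close>

lift_definition point_evaluation :: "'k::topological_space \<Rightarrow> ('k \<Rightarrow>\<^sub>C real) \<Rightarrow>\<^sub>L real"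
  is "\<lambda>k f. apply_bcontfun f k"
  by (rule bounded_linear_intro[where K = 1]) (simp_all add: norm_bounded del: real_norm_def)

end

theory Submission
  imports Defs
begin

text \<open>
  A compact operator \<open>T\<close> into \<open>C(K)\<close> is determined by its rows \<open>g k = T\<^sup>* \<delta>\<^sub>k\<close>, which depend
  norm-continuously on \<open>k\<close>, so that the norm of \<open>T\<close> is the maximum of \<open>norm (g k)\<close>. Let the maximum
  be attained at \<open>k\<^sub>0\<close>. If \<open>g k\<^sub>1 \<noteq> 0\<close> for another point \<open>k\<^sub>1\<close>, choose a continuous \<open>\<phi> \<ge> 0\<close> with
  \<open>\<phi> k\<^sub>0 = 0\<close> and \<open>\<phi> k\<^sub>1 = 1\<close>. Then \<open>T \<bottom>\<^sub>B \<phi> T\<close> because the row of \<open>\<phi> T\<close> at \<open>k\<^sub>0\<close> vanishes, but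
  \<open>norm ((\<phi> - c) T) < norm (\<phi> T)\<close> for small \<open>c > 0\<close>. Hence a left symmetric \<open>T\<close> is carried by the
  single point \<open>k\<^sub>0\<close>, which is then isolated, and orthogonality for \<open>T\<close> reduces to orthogonality
  for \<open>g k\<^sub>0\<close>.
\<close>

section \<open>Local orthogonality and sources of compact operators\<close>

text \<open>The map \<open>c \<mapsto> norm (x + c *\<^sub>R y)\<close> is convex, so a local
  minimum at \<open>0\<close> is a global one.\<close>

lemma birkhoff_james_local:
  fixes x y :: "'a::real_normed_vector"
  assumes "0 < d" and small: "\<And>c. \<bar>c\<bar> < d \<Longrightarrow> norm x \<le> norm (x + c *\<^sub>R y)"
  shows "x \<bottom>\<^sub>B y"
  unfolding birkhoff_james_def
proof
  fix c :: real
  \<comment> \<open>Shrinks \<open>c\<close> to \<open>t * c\<close> inside the window of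
    \<open>small\<close>; \<open>t \<le> 1\<close> is for the convex combination below, and the
    \<open>+ 1\<close> covers \<open>c = 0\<close>.\<close>
  define t where "t = min 1 (d / (2 * (\<bar>c\<bar> + 1)))"
  have t: "0 < t" "t \<le> 1" using \<open>0 < d\<close> by (auto simp: t_def)
  have "t * \<bar>c\<bar> \<le> d / (2 * (\<bar>c\<bar> + 1)) * \<bar>c\<bar>"
    by (intro mult_right_mono) (auto simp: t_def)
  also have "\<dots> < d" using \<open>0 < d\<close> by (simp add: field_simps add_strict_increasing)
  finally have "norm x \<le> norm (x + (t * c) *\<^sub>R y)"
    using t by (intro small) (simp add: abs_mult)
  also have "x + (t * c) *\<^sub>R y = (1 - t) *\<^sub>R x + t *\<^sub>R (x + c *\<^sub>R y)"
    by (simp add: algebra_simps)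
  also have "norm \<dots> \<le> (1 - t) * norm x + t * norm (x + c *\<^sub>R y)"
    using t by (intro norm_triangle_le) simp
  finally have "t * norm x \<le> t * norm (x + c *\<^sub>R y)" by (simp add: algebra_simps)
  then show "norm x \<le> norm (x + c *\<^sub>R y)" using t by simp
qed

lemma compact_operatorsI:
  fixes T :: "'a::real_normed_vector \<Rightarrow>\<^sub>L 'b::real_normed_vector"
  assumes "compact C" and "blinfun_apply T ` cball 0 1 \<subseteq> C"
  shows "T \<in> compact_operators"
proof -
  have "closure (blinfun_apply T ` cball 0 1) \<subseteq> C"
    using assms by (intro closure_minimal compact_imp_closed)
  then have "closure (blinfun_apply T ` cball 0 1) = C \<inter> closure (blinfun_apply T ` cball 0 1)"
    by blast
  then show ?thesis
    using assms(1) unfolding compact_operators_def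
    by (metis closed_closure compact_Int_closed mem_Collect_eq)
qed

text \<open>A continuous image of a compact set is compact. Every test operator below gets its
  compactness from such a factorization.\<close>

lemma compact_operators_comp_left:
  fixes S :: "'b::real_normed_vector \<Rightarrow>\<^sub>L 'c::real_normed_vector"
  assumes "T \<in> compact_operators"
  shows "S o\<^sub>L T \<in> compact_operators"
proof (rule compact_operatorsI)
  let ?C = "closure (blinfun_apply T ` cball 0 1)"
  show "compact (blinfun_apply S ` ?C)"
    using assms unfolding compact_operators_def
    by (intro compact_continuous_image) (auto intro: continuous_intros)
  show "blinfun_apply (S o\<^sub>L T) ` cball 0 1 \<subseteq> blinfun_apply S ` ?C"
    using closure_subset by fastforce
qed

text \<open>The operator factors through the real line, where the image of the unit ball lies in a
  compact interval.\<close>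

lemma compact_operators_rank_one:
  fixes y :: "'a::real_normed_vector \<Rightarrow>\<^sub>L real" and e :: "'b::real_normed_vector"
  shows "blinfun_scaleR_left e o\<^sub>L y \<in> compact_operators"
proof (rule compact_operators_comp_left, rule compact_operatorsI)
  show "blinfun_apply y ` cball 0 1 \<subseteq> cball 0 (norm y)"
  proof clarsimp
    fix x :: 'a assume "norm x \<le> 1"
    then show "\<bar>blinfun_apply y x\<bar> \<le> norm y"
      using norm_blinfun[of y x] mult_left_mono[of "norm x" 1 "norm y"] by simp
  qed
qed simp

text \<open>Multiplication by \<open>\<phi>\<close> as a bounded operator turns the product of
  \<open>\<phi>\<close> and \<open>T\<close> into a composition, which inherits compactness from
  \<open>T\<close>.\<close>

lemma ex_mult_bcontfun:
  fixes \<phi> :: "'k::topological_space \<Rightarrow>\<^sub>C real"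
  obtains M :: "('k \<Rightarrow>\<^sub>C real) \<Rightarrow>\<^sub>L ('k \<Rightarrow>\<^sub>C real)"
  where "\<And>f k. M f k = \<phi> k * f k"
proof -
  have bound: "norm (\<phi> k * f k) \<le> norm f * norm \<phi>" for f :: "'k \<Rightarrow>\<^sub>C real" and k
    using mult_mono[OF norm_bounded[of \<phi> k] norm_bounded[of f k]]
    by (simp add: abs_mult mult.commute)
  have bc: "(\<lambda>k. \<phi> k * f k) \<in> bcontfun" for f :: "'k \<Rightarrow>\<^sub>C real"
    by (rule bcontfun_normI[OF _ bound]) (intro continuous_intros continuous_on_apply_bcontfun)
  define m where "m f = Bcontfun (\<lambda>k. \<phi> k * f k)" for f :: "'k \<Rightarrow>\<^sub>C real"
  have m: "m f k = \<phi> k * f k" for f k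
    using bc by (simp add: m_def Bcontfun_inverse)
  have "bounded_linear m"
  proof (rule bounded_linear_intro)
    show "norm (m f) \<le> norm f * norm \<phi>" for f
      using bound by (intro norm_bound) (simp add: m)
  qed (auto intro!: bcontfun_eqI simp: m algebra_simps)
  then show ?thesis
    using m by (intro that[of "Blinfun m"]) (simp add: bounded_linear_Blinfun_apply)
qed

section \<open>Rows of an operator into C(K)\<close>

abbreviation point_row :: "('x::real_normed_vector \<Rightarrow>\<^sub>L ('k::topological_space \<Rightarrow>\<^sub>C real))
    \<Rightarrow> 'k \<Rightarrow> 'x \<Rightarrow>\<^sub>L real"
  where "point_row T k \<equiv> banach_adjoint T (point_evaluation k)"

lemma row_apply: "point_row T k x = T x k"
  by (simp add: banach_adjoint.rep_eq point_evaluation.rep_eq)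

lemma row_add_scaleR: "point_row (T + c *\<^sub>R S) k = point_row T k + c *\<^sub>R point_row S k"
  by (rule blinfun_eqI) (simp add: row_apply blinfun.add_left blinfun.scaleR_left)

lemma norm_row_le: "norm (point_row T k) \<le> norm T"
proof (rule norm_blinfun_bound)
  show "norm (point_row T k x) \<le> norm T * norm x" for x
    using norm_bounded[of "T x" k] norm_blinfun[of T x] by (simp add: row_apply)
qed simp

text \<open>The suprema over the unit ball and over the points of K can be exchanged; together with
  \<open>norm_row_le\<close>, the operator norm is the supremum of the row norms.\<close>

lemma norm_le_rows:
  assumes "\<And>k. norm (point_row T k) \<le> b"
  shows "norm T \<le> b"
proof (rule norm_blinfun_bound)
  show "0 \<le> b" using assms norm_ge_zero order_trans by blast
  show "norm (T x) \<le> b * norm x" for x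
  proof (rule norm_bound)
    fix k
    have "norm (T x k) \<le> norm (point_row T k) * norm x"
      using norm_blinfun[of "point_row T k" x] by (simp add: row_apply)
    also have "\<dots> \<le> b * norm x" by (intro mult_right_mono assms) simp
    finally show "norm (T x k) \<le> b * norm x" .
  qed
qed

text \<open>A finite net of the image of the unit ball makes that image equicontinuous.\<close>

lemma continuous_on_row:
  fixes T :: "'x::real_normed_vector \<Rightarrow>\<^sub>L ('k::topological_space \<Rightarrow>\<^sub>C real)"
  assumes "T \<in> compact_operators"
  shows "continuous_on UNIV (point_row T)"
proof -
  have "\<forall>\<^sub>F k' in at k. dist (point_row T k') (point_row T k) < e" if "0 < e" for k and e :: real
  proof -
    \<comment> \<open>The radius \<open>e/4\<close> is spent three times: on the approximation of
      \<open>T x\<close> by \<open>f\<close> at \<open>k\<close> and at \<open>k'\<close>, and on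
      the variation of \<open>f\<close>. The last quarter restores strictness after the supremum
      over \<open>x\<close>.\<close>
    obtain F where F: "finite F" "closure (blinfun_apply T ` cball 0 1) \<subseteq> (\<Union>f\<in>F. ball f (e/4))"
    proof -
      have "\<forall>e>0. \<exists>F. finite F \<and> closure (blinfun_apply T ` cball 0 1) \<subseteq> (\<Union>f\<in>F. ball f e)"
        using assms unfolding compact_operators_def compact_eq_totally_bounded by blast
      moreover have "0 < e/4" using \<open>0 < e\<close> by simp
      ultimately show ?thesis using that by blast
    qed
    have "\<forall>\<^sub>F k' in at k. \<forall>f\<in>F. dist (f k') (f k) < e/4"
    proof (rule eventually_ball_finite[OF F(1)], rule ballI)
      fix f assume "f \<in> F"
      have "(apply_bcontfun f \<longlongrightarrow> f k) (at k)"
        using continuous_on_apply_bcontfun[of UNIV f] by (simp add: continuous_on_def)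
      then show "\<forall>\<^sub>F k' in at k. dist (f k') (f k) < e/4"
        using \<open>0 < e\<close> by (intro tendstoD) auto
    qed
    then show ?thesis
    proof (rule eventually_mono)
      fix k' assume near: "\<forall>f\<in>F. dist (f k') (f k) < e/4"
      have unit: "\<bar>T x k' - T x k\<bar> \<le> 3/4 * e" if "norm x \<le> 1" for x
      proof -
        have "T x \<in> closure (blinfun_apply T ` cball 0 1)"
          using that by (intro set_mp[OF closure_subset]) simp
        then obtain f where f: "f \<in> F" "dist f (T x) < e/4" using F(2) by auto
        have "dist (f j) (T x j) < e/4" for j
          using dist_bounded[of f j "T x"] f(2) by simp
        from this[of k] this[of k'] bspec[OF near f(1)] show ?thesis
          unfolding dist_real_def by linarith
      qed
      have "norm (point_row T k' - point_row T k) \<le> 3/4 * e"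
      proof (rule norm_blinfun_bound)
        fix x
        show "norm ((point_row T k' - point_row T k) x) \<le> 3/4 * e * norm x"
        proof (cases "x = 0")
          case False
          have "\<bar>T (x /\<^sub>R norm x) k' - T (x /\<^sub>R norm x) k\<bar> = \<bar>T x k' - T x k\<bar> / norm x"
            by (simp add: blinfun.scaleR_right divide_inverse abs_mult flip: right_diff_distrib)
          moreover have "\<bar>T (x /\<^sub>R norm x) k' - T (x /\<^sub>R norm x) k\<bar> \<le> 3/4 * e"
            by (rule unit) (use False in simp)
          ultimately have "\<bar>T x k' - T x k\<bar> / norm x \<le> 3/4 * e" by metis
          then have "\<bar>T x k' - T x k\<bar> \<le> 3/4 * e * norm x"
            using False by (subst (asm) pos_divide_le_eq) auto
          then show ?thesis by (simp add: row_apply blinfun.diff_left)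
        qed simp
      qed (use \<open>0 < e\<close> in simp)
      then show "dist (point_row T k') (point_row T k) < e" using \<open>0 < e\<close> by (simp add: dist_norm)
    qed
  qed
  then show ?thesis by (auto simp: continuous_on_def intro: tendstoI)
qed

text \<open>The row norm is a continuous function on a compact space. Attainment matters because a
  strict estimate at each point then gives a strict estimate of the operator norm.\<close>

lemma norm_row_attained:
  fixes T :: "'x::real_normed_vector \<Rightarrow>\<^sub>L ('k::topological_space \<Rightarrow>\<^sub>C real)"
  assumes "compact (UNIV :: 'k set)" and "T \<in> compact_operators"
  obtains k where "norm (point_row T k) = norm T"
proof -
  have "continuous_on UNIV (\<lambda>k. norm (point_row T k))"
    by (intro continuous_on_norm continuous_on_row assms)
  then obtain k where "\<And>j. norm (point_row T j) \<le> norm (point_row T k)"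
    using continuous_attains_sup[OF assms(1)] by auto
  then have "norm (point_row T k) = norm T"
    by (intro antisym norm_row_le norm_le_rows)
  then show ?thesis by (rule that)
qed

section \<open>Support of a left symmetric operator\<close>

lemma left_symmetric_in_support:
  fixes T :: "'x::real_normed_vector \<Rightarrow>\<^sub>L ('k::t2_space \<Rightarrow>\<^sub>C real)"
  assumes K: "compact (UNIV :: 'k set)" "normal_space (euclidean :: 'k topology)"
    and sym: "left_symmetric_in compact_operators T"
    and k0: "norm (point_row T k0) = norm T" and "k \<noteq> k0"
  shows "point_row T k = 0"
proof (rule ccontr)
  assume nz: "point_row T k \<noteq> 0"
  have T: "T \<in> compact_operators" using sym by (simp add: left_symmetric_in_def)
  obtain p where p: "continuous_map euclidean (top_of_set {0..1::real}) p" "p k0 = 0" "p k = 1"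
    using Urysohn_lemma[OF K(2), of "{k0}" "{k}" 0 1] \<open>k \<noteq> k0\<close> by auto
  then have cont: "continuous_on UNIV p" and p01: "0 \<le> p j" "p j \<le> 1" for j
    by (auto simp: continuous_map_in_subtopology)
  have "p \<in> bcontfun"
    using p01 by (intro bcontfun_normI[OF cont, of 1]) simp
  then obtain \<phi> :: "'k \<Rightarrow>\<^sub>C real" where \<phi>: "apply_bcontfun \<phi> = p"
    using Bcontfun_inverse by blast
  obtain M :: "('k \<Rightarrow>\<^sub>C real) \<Rightarrow>\<^sub>L ('k \<Rightarrow>\<^sub>C real)" where M: "\<And>f j. M f j = p j * f j"
    using ex_mult_bcontfun[of \<phi>] \<phi> by metis
  define S where "S = M o\<^sub>L T"
  have S: "S \<in> compact_operators"
    unfolding S_def by (rule compact_operators_comp_left[OF T])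
  have rowS: "point_row S j = p j *\<^sub>R point_row T j" for j
    by (rule blinfun_eqI) (simp add: row_apply S_def M blinfun.scaleR_left)
  have "T \<bottom>\<^sub>B S"
    unfolding birkhoff_james_def
  proof
    fix c
    have "point_row (T + c *\<^sub>R S) k0 = point_row T k0" by (simp add: row_add_scaleR rowS p)
    then show "norm T \<le> norm (T + c *\<^sub>R S)" using k0 norm_row_le by metis
  qed
  then have orth: "norm S \<le> norm (S + c *\<^sub>R T)" for c
    using sym S by (simp add: left_symmetric_in_def birkhoff_james_def)
  have Spos: "0 < norm S"
  proof -
    have "0 < norm (point_row S k)" using nz by (simp add: rowS p)
    then show ?thesis using norm_row_le order_less_le_trans by blast
  qed
  \<comment> \<open>Small enough for \<open>c * norm T < norm S\<close>, yet positive; the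
    \<open>+ 1\<close> keeps the denominator positive.\<close>
  define c where "c = norm S / (2 * (norm T + 1))"
  have "0 < c" using Spos by (simp add: c_def add_nonneg_pos)
  have "c * norm T < norm S"
  proof -
    have "norm S * norm T < norm S * (2 * (norm T + 1))"
      using Spos by (intro mult_strict_left_mono) (auto intro: add_nonneg_pos)
    then show ?thesis by (simp add: c_def divide_simps add_nonneg_pos mult.commute)
  qed
  have "S + (- c) *\<^sub>R T \<in> compact_operators"
  proof -
    \<comment> \<open>A single operator applied after \<open>T\<close>, so compactness again follows
      by composition.\<close>
    have "S + (- c) *\<^sub>R T = (M + (- c) *\<^sub>R id_blinfun) o\<^sub>L T"
      by (rule blinfun_eqI) (simp add: S_def blinfun.diff_left blinfun.scaleR_left)
    then show ?thesis using compact_operators_comp_left[OF T] by metis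
  qed
  then obtain j where j: "norm (point_row (S + (- c) *\<^sub>R T) j) = norm (S + (- c) *\<^sub>R T)"
    by (rule norm_row_attained[OF K(1)])
  have "point_row (S + (- c) *\<^sub>R T) j = (p j - c) *\<^sub>R point_row T j"
    by (simp only: row_add_scaleR rowS scaleR_add_left[symmetric]) simp
  then have le: "norm S \<le> \<bar>p j - c\<bar> * norm (point_row T j)"
    using orth[of "- c"] j by simp
  show False
  \<comment> \<open>Where \<open>p j < c\<close>, the factor is at most \<open>c\<close> in absolute
    value, so the row is shorter than \<open>norm S\<close> by the choice of \<open>c\<close>.
    Elsewhere, subtracting \<open>c\<close> strictly shortens the row of \<open>S\<close>, since
    \<open>le\<close> forces row \<open>j\<close> of \<open>T\<close> to be nonzero.\<close>
  proof (cases "p j < c")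
    case True
    then have "\<bar>p j - c\<bar> * norm (point_row T j) \<le> c * norm T"
      using p01[of j] \<open>0 < c\<close> by (intro mult_mono norm_row_le) auto
    then show False using le \<open>c * norm T < norm S\<close> by simp
  next
    case False
    then have "\<bar>p j - c\<bar> * norm (point_row T j) = norm (point_row S j) - c * norm (point_row T j)"
      using p01[of j] by (simp add: rowS algebra_simps)
    moreover have "point_row T j \<noteq> 0" using le Spos by auto
    ultimately show False
      using le norm_row_le[of S j] \<open>0 < c\<close> by (smt (verit) mult_pos_pos zero_less_norm_iff)
  qed
qed

text \<open>Rows depend continuously on the point, so those with a nonzero row form an open set,
  here \<open>{k0}\<close>.\<close>

lemma isolated_in_row_support:
  fixes T :: "'x::real_normed_vector \<Rightarrow>\<^sub>L ('k::topological_space \<Rightarrow>\<^sub>C real)"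
  assumes "T \<in> compact_operators" and "point_row T k0 \<noteq> 0" and "\<And>k. k \<noteq> k0 \<Longrightarrow> point_row T k = 0"
  shows "k0 isolated_in UNIV"
proof -
  have "open (point_row T -` (- {0}))"
    by (intro open_vimage continuous_on_row assms) auto
  moreover have "point_row T -` (- {0}) = {k0}" using assms(2,3) by auto
  ultimately show ?thesis unfolding isolated_in_def by auto
qed

section \<open>Transfer of left symmetry between an operator and its only row\<close>

text \<open>A test functional \<open>y\<close> becomes a test operator by placing it as the only row
  at \<open>k0\<close>; conversely a test operator \<open>S\<close> is restricted to its row at
  \<open>k0\<close>, its other rows being unchanged when multiples of \<open>T\<close> are
  added.\<close>

lemma left_symmetric_in_iff_row:
  fixes T :: "'x::real_normed_vector \<Rightarrow>\<^sub>L ('k::t2_space \<Rightarrow>\<^sub>C real)"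
  assumes K: "compact (UNIV :: 'k set)" and T: "T \<in> compact_operators"
    and "T \<noteq> 0" and supp: "\<And>k. k \<noteq> k0 \<Longrightarrow> point_row T k = 0"
  shows "left_symmetric_in compact_operators T \<longleftrightarrow> left_symmetric_in UNIV (point_row T k0)"
proof -
  obtain k1 where "norm (point_row T k1) = norm T" by (rule norm_row_attained[OF K T])
  then have k0: "norm (point_row T k0) = norm T"
    using supp[of k1] \<open>T \<noteq> 0\<close> by (cases "k1 = k0") auto
  show ?thesis
  proof
    assume sym: "left_symmetric_in compact_operators T"
    have "k0 isolated_in UNIV"
      using k0 \<open>T \<noteq> 0\<close> by (intro isolated_in_row_support[OF T _ supp]) auto
    then have "open {k0}" by (auto simp: isolated_in_def)
    \<comment> \<open>Since \<open>{k0}\<close> is open and closed, its indicator is continuous; it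
      carries \<open>y\<close> to the row at \<open>k0\<close>.\<close>
    have "indicator {k0} \<in> (bcontfun :: ('k \<Rightarrow> real) set)"
    proof (rule bcontfun_normI)
      have "open (indicator {k0} -` B :: 'k set)" for B :: "real set"
      proof -
        have "indicator {k0} -` B = (if 1 \<in> B then {k0} else {}) \<union> (if 0 \<in> B then - {k0} else {})"
          by (auto simp: indicator_def of_bool_def split: if_splits)
        then show ?thesis using \<open>open {k0}\<close> by (auto intro: open_Compl)
      qed
      then show "continuous_on UNIV (indicator {k0} :: 'k \<Rightarrow> real)"
        by (simp add: continuous_on_open_vimage)
      show "norm (indicator {k0} k :: real) \<le> 1" for k by (simp add: indicator_def)
    qed
    then obtain e :: "'k \<Rightarrow>\<^sub>C real" where e: "apply_bcontfun e = indicator {k0}"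
      using Bcontfun_inverse by blast
    have "y \<bottom>\<^sub>B point_row T k0" if "point_row T k0 \<bottom>\<^sub>B y" for y
    proof -
      define S where "S = blinfun_scaleR_left e o\<^sub>L y"
      have S: "S \<in> compact_operators" unfolding S_def by (rule compact_operators_rank_one)
      have S0: "point_row S k0 = y"
        by (rule blinfun_eqI) (simp add: row_apply S_def e)
      have S1: "point_row S k = 0" if "k \<noteq> k0" for k
        by (rule blinfun_eqI) (simp add: row_apply S_def e that)
      have "T \<bottom>\<^sub>B S"
        unfolding birkhoff_james_def
      proof
        fix c
        have "norm T \<le> norm (point_row (T + c *\<^sub>R S) k0)"
          using that k0 by (simp add: row_add_scaleR S0 birkhoff_james_def)
        then show "norm T \<le> norm (T + c *\<^sub>R S)" using norm_row_le order_trans by blast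
      qed
      then have ST: "norm S \<le> norm (S + c *\<^sub>R T)" for c
        using sym S by (simp add: left_symmetric_in_def birkhoff_james_def)
      show ?thesis
        unfolding birkhoff_james_def
      proof
        fix c
        have "norm y \<le> norm S" using norm_row_le[of S k0] by (simp add: S0)
        also have "\<dots> \<le> norm (S + c *\<^sub>R T)" by (rule ST)
        also have "\<dots> \<le> norm (y + c *\<^sub>R point_row T k0)"
        proof (rule norm_le_rows)
          show "norm (point_row (S + c *\<^sub>R T) k) \<le> norm (y + c *\<^sub>R point_row T k0)" for k
            by (cases "k = k0") (simp_all add: row_add_scaleR S0 S1 supp)
        qed
        finally show "norm y \<le> norm (y + c *\<^sub>R point_row T k0)" .
      qed
    qed
    then show "left_symmetric_in UNIV (point_row T k0)" by (simp add: left_symmetric_in_def)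
  next
    assume sym: "left_symmetric_in UNIV (point_row T k0)"
    have "S \<bottom>\<^sub>B T" if "T \<bottom>\<^sub>B S" for S
    proof -
      \<comment> \<open>For \<open>\<bar>c\<bar> < d\<close>, the rows of
        \<open>T + c *\<^sub>R S\<close> away from \<open>k0\<close> have norm at most
        \<open>\<bar>c\<bar> * norm S < norm T\<close>, so the lower bound \<open>norm T\<close>
        must come from the row at \<open>k0\<close>.\<close>
      define d where "d = norm T / (norm S + 1)"
      have "0 < d" using \<open>T \<noteq> 0\<close> by (simp add: d_def add_nonneg_pos)
      have "point_row T k0 \<bottom>\<^sub>B point_row S k0"
      proof (rule birkhoff_james_local[OF \<open>0 < d\<close>])
        fix c :: real assume c: "\<bar>c\<bar> < d"
        have "\<bar>c\<bar> * norm S \<le> \<bar>c\<bar> * (norm S + 1)" by (simp add: algebra_simps)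
        also have "\<dots> < norm T" using c by (simp add: d_def pos_less_divide_eq add_nonneg_pos)
        finally have cS: "\<bar>c\<bar> * norm S < norm T" .
        have "norm T \<le> norm (T + c *\<^sub>R S)" using that by (simp add: birkhoff_james_def)
        also have "\<dots> \<le> max (norm (point_row T k0 + c *\<^sub>R point_row S k0)) (\<bar>c\<bar> * norm S)"
        proof (rule norm_le_rows)
          show "norm (point_row (T + c *\<^sub>R S) k)
              \<le> max (norm (point_row T k0 + c *\<^sub>R point_row S k0)) (\<bar>c\<bar> * norm S)" for k
            by (cases "k = k0")
              (auto simp: row_add_scaleR supp le_max_iff_disj intro!: mult_left_mono norm_row_le)
        qed
        finally show "norm (point_row T k0) \<le> norm (point_row T k0 + c *\<^sub>R point_row S k0)"
          using cS k0 by simp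
      qed
      then have orth: "norm (point_row S k0) \<le> norm (point_row S k0 + c *\<^sub>R point_row T k0)" for c
        using sym by (simp add: left_symmetric_in_def birkhoff_james_def)
      show ?thesis
        unfolding birkhoff_james_def
      proof (intro allI norm_le_rows)
        fix c k
        have "norm (point_row S k) \<le> norm (point_row (S + c *\<^sub>R T) k)"
          using orth supp by (cases "k = k0") (simp_all add: row_add_scaleR)
        then show "norm (point_row S k) \<le> norm (S + c *\<^sub>R T)" using norm_row_le order_trans by blast
      qed
    qed
    then show "left_symmetric_in compact_operators T" using T by (simp add: left_symmetric_in_def)
  qed
qed

section \<open>Characterization of left symmetric operators\<close>

theorem proposition3p25:
  fixes T :: "'x::banach \<Rightarrow>\<^sub>L ('k::t2_space \<Rightarrow>\<^sub>C real)"
  assumes "compact (UNIV :: 'k set)"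
    and "perfectly_normal_space (euclidean :: 'k topology)"
    and "T \<in> compact_operators"
  shows "(norm T = 1 \<longrightarrow>
            (left_symmetric_in compact_operators T \<longleftrightarrow>
              (\<exists>!k0. norm (banach_adjoint T (point_evaluation k0)) = 1 \<and>
                 (\<forall>k \<in> UNIV - {k0}. banach_adjoint T (point_evaluation k) = 0)) \<and>
              (\<forall>k0. norm (banach_adjoint T (point_evaluation k0)) = 1 \<and>
                 (\<forall>k \<in> UNIV - {k0}. banach_adjoint T (point_evaluation k) = 0) \<longrightarrow>
                 left_symmetric_in UNIV (banach_adjoint T (point_evaluation k0))))) \<and>
         ((\<nexists>k::'k. k isolated_in UNIV) \<longrightarrow>
            (left_symmetric_in compact_operators T \<longleftrightarrow> T = 0))"
proof (intro conjI impI)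
  have normal: "normal_space (euclidean :: 'k topology)"
    using assms(2) by (simp add: perfectly_normal_space_def)
  note support = left_symmetric_in_support[OF assms(1) normal]
  {
    let ?P = "\<lambda>k0. norm (point_row T k0) = 1 \<and> (\<forall>k \<in> UNIV - {k0}. point_row T k = 0)"
    assume "norm T = 1"
    then have "T \<noteq> 0" by auto
    have reduce: "left_symmetric_in compact_operators T \<longleftrightarrow> left_symmetric_in UNIV (point_row T k0)"
      if "?P k0" for k0
      using that by (intro left_symmetric_in_iff_row[OF assms(1,3) \<open>T \<noteq> 0\<close>]) auto
    \<comment> \<open>Otherwise row \<open>k\<close> would be both zero and of norm 1.\<close>
    have unique: "k = k0" if "?P k0" "?P k" for k k0
      using that by (metis DiffI UNIV_I norm_zero singletonD zero_neq_one)
    obtain k0 where k0: "norm (point_row T k0) = norm T"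
      by (rule norm_row_attained[OF assms(1,3)])
    have ex: "?P k0" if "left_symmetric_in compact_operators T"
      using support[OF that k0] k0 \<open>norm T = 1\<close> by auto
    show "left_symmetric_in compact_operators T \<longleftrightarrow>
        (\<exists>!k0. ?P k0) \<and> (\<forall>k0. ?P k0 \<longrightarrow> left_symmetric_in UNIV (point_row T k0))"
    proof
      assume sym: "left_symmetric_in compact_operators T"
      show "(\<exists>!k0. ?P k0) \<and> (\<forall>k0. ?P k0 \<longrightarrow> left_symmetric_in UNIV (point_row T k0))"
        using ex1I[of ?P, OF ex[OF sym] unique[OF ex[OF sym]]] reduce sym by blast
    next
      assume "(\<exists>!k0. ?P k0) \<and> (\<forall>k0. ?P k0 \<longrightarrow> left_symmetric_in UNIV (point_row T k0))"
      then obtain k where "?P k" "left_symmetric_in UNIV (point_row T k)" by blast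
      then show "left_symmetric_in compact_operators T" using reduce by blast
    qed
  next
    assume isolated: "\<nexists>k::'k. k isolated_in UNIV"
    show "left_symmetric_in compact_operators T \<longleftrightarrow> T = 0"
    proof
      assume sym: "left_symmetric_in compact_operators T"
      obtain k0 where k0: "norm (point_row T k0) = norm T"
        by (rule norm_row_attained[OF assms(1,3)])
      \<comment> \<open>A nonzero row here would be the only one and would make \<open>k0\<close>
        isolated. Being a row of maximal norm, it takes \<open>T\<close> to zero with it.\<close>
      have "point_row T k0 = 0"
        using isolated_in_row_support[OF assms(3) _ support[OF sym k0]] isolated by blast
      then show "T = 0" using k0 by simp
    next
      assume "T = 0"
      then show "left_symmetric_in compact_operators T"
        using assms(3) by (auto simp: left_symmetric_in_def birkhoff_james_def)
    qed
  }
qed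

end
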